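(* Let $\epsilon>0$ and let $PCR:\mathcal{D}_\epsilon\to \mathrm{SE}(3)$ be the point cloud registration map defined in the context. Then $PCR$ is invariant to the ordering of the points: for every $(X,Y)\in\mathcal{D}_\epsilon$ with $X\in\mathbb{R}^{3\times N}$, $Y\in\mathbb{R}^{3\times M}$, and all permutations $\pi\in S_N$, $\tau\in S_M$ (acting by permuting the points, i.e. the columns), the pair $(\pi X,\tau Y)$ belongs to $\mathcal{D}_\epsilon$ and $$PCR(\pi X,\tau Y)=PCR(X,Y).$$
   Context: $S_N$ is the group of permutations of $N$ points. $\mathrm{SE}(3)$ is the group of rigid motions $\mathcal{T}=(R,T)$, $R\in \mathrm{SO}(3)$, $T\in\mathbb{R}^3$, acting on $\mathbb{R}^3$ by $\mathcal{T}x=Rx+T$. A point cloud is a finite tuple $X=(x_1,\dots,x_N)\in\mathbb{R}^{3\times N}$, $N>0$. Fix $\epsilon>0$. For point clouds $X=(x_1,\dots,x_N)$ (reference), $Y=(y_1,\dots,y_M)$ (source) and $\mathcal{T}\in \mathrm{SE}(3)$, the set of point matches for $\mathcal{T}$ is $C_{\mathcal{T}}(X,Y)=\{(i,j): \|x_i-\mathcal{T}y_j\|_2\le\epsilon\}$. Call $\mathcal{T}$ a registration of $(X,Y)$ if $\mathcal{T}$ is the unique minimizer over $\mathcal{S}\in \mathrm{SE}(3)$ of the Procrustes objective $\sum_{(i,j)\in C_{\mathcal{T}}(X,Y)}\|\mathcal{S}y_j-x_i\|_2^2$. Let $\mathcal{D}_\epsilon\subseteq \bigcup_{N>0}\mathbb{R}^{3\times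 N}\times\bigcup_{M>0}\mathbb{R}^{3\times M}$ be the set of pairs $(X,Y)$ that have exactly one registration (standing assumption of unique alignment), and let $PCR(X,Y)\in \mathrm{SE}(3)$ be that registration. *)

theory Defs
  imports "HOL-Analysis.Analysis" "HOL-Combinatorics.Permutations"
begin

text \<open>A point cloud is a nonempty list of points of three-dimensional space, indexed from 0, and
  a rigid motion is a pair of a rotation matrix and a translation vector.\<close>

type_synonym cloud = "(real^3) list"
type_synonym motion = "(real^3^3) \<times> (real^3)"

definition SE3 :: "motion set" where
  "SE3 = {(R, t). rotation_matrix R}"

definition act :: "motion \<Rightarrow> real^3 \<Rightarrow> real^3" where
  "act T x = fst T *v x + snd T"

definition matches :: "real \<Rightarrow> motion \<Rightarrow> cloud \<Rightarrow> cloud \<Rightarrow> (nat \<times> nat) set" where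
  "matches \<epsilon> T X Y =
     {(i, j). i < length X \<and> j < length Y \<and> norm (X ! i - act T (Y ! j)) \<le> \<epsilon>}"

definition procrustes :: "(nat \<times> nat) set \<Rightarrow> cloud \<Rightarrow> cloud \<Rightarrow> motion \<Rightarrow> real" where
  "procrustes C X Y S = (\<Sum>(i, j)\<in>C. (norm (act S (Y ! j) - X ! i))\<^sup>2)"

text \<open>The matches are those of the motion \<open>T\<close> itself and stay fixed while the objective is
  minimized over \<open>S\<close>.\<close>

definition is_registration :: "real \<Rightarrow> cloud \<Rightarrow> cloud \<Rightarrow> motion \<Rightarrow> bool" where
  "is_registration \<epsilon> X Y T \<longleftrightarrow>
     {S. is_arg_min (procrustes (matches \<epsilon> T X Y) X Y) (\<lambda>S. S \<in> SE3) S} = {T}"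

definition PCR_domain :: "real \<Rightarrow> (cloud \<times> cloud) set" where
  "PCR_domain \<epsilon> = {(X, Y). X \<noteq> [] \<and> Y \<noteq> [] \<and> (\<exists>!T. is_registration \<epsilon> X Y T)}"

text \<open>Only meaningful on \<^const>\<open>PCR_domain\<close>.\<close>

definition PCR :: "real \<Rightarrow> cloud \<Rightarrow> cloud \<Rightarrow> motion" where
  "PCR \<epsilon> X Y = (THE T. is_registration \<epsilon> X Y T)"

end

theory Submission
  imports Defs
begin

text \<open>The map \<open>(i, j) \<mapsto> (\<pi> i, \<tau> j)\<close> is a bijection from the matches of the permuted clouds to those of
  the original ones that preserves the points involved. Hence every motion has the same Procrustes
  objective for both pairs, and the two pairs have the same registrations.\<close>

lemma bij_betw_matches_permute_list:
  assumes \<pi>: "\<pi> permutes {..<length X}" and \<tau>: "\<tau> permutes {..<length Y}"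
  shows "bij_betw (map_prod \<pi> \<tau>)
    (matches \<epsilon> T (permute_list \<pi> X) (permute_list \<tau> Y)) (matches \<epsilon> T X Y)"
proof -
  let ?I = "{..<length X} \<times> {..<length Y}"
  let ?M = "matches \<epsilon> T (permute_list \<pi> X) (permute_list \<tau> Y)"
  have bij: "bij_betw (map_prod \<pi> \<tau>) ?I ?I"
    using permutes_imp_bij[OF \<pi>] permutes_imp_bij[OF \<tau>] by (rule bij_betw_map_prod)
  \<comment> \<open>Entry \<open>i\<close> of \<open>permute_list \<pi> X\<close> is
    \<open>X ! \<pi> i\<close>, so both memberships reduce to the same distance inequality once all
    indices are in range.\<close>
  have iff: "map_prod \<pi> \<tau> p \<in> matches \<epsilon> T X Y \<longleftrightarrow> p \<in> ?M" if "p \<in> ?I" for p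
  proof -
    obtain i j where p: "p = (i, j)" "i < length X" "j < length Y"
      using \<open>p \<in> ?I\<close> by auto
    then have "\<pi> i < length X" "\<tau> j < length Y"
      using permutes_in_image[OF \<pi>, of i] permutes_in_image[OF \<tau>, of j] by auto
    with p show ?thesis
      by (simp add: matches_def permute_list_nth[OF \<pi>] permute_list_nth[OF \<tau>])
  qed
  have sub: "matches \<epsilon> T X Y \<subseteq> ?I" "?M \<subseteq> ?I"
    by (auto simp: matches_def)
  \<comment> \<open>Injectivity is inherited from \<open>bij\<close>, so only the image has to be
    computed. A match \<open>q\<close> has a preimage in \<open>?I\<close> by surjectivity there,
    and \<open>iff\<close> places that preimage in \<open>?M\<close>.\<close>
  have "map_prod \<pi> \<tau> ` ?M = matches \<epsilon> T X Y"
  proof (intro subset_antisym subsetI)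
    fix q assume "q \<in> map_prod \<pi> \<tau> ` ?M"
    then obtain p where p: "p \<in> ?M" "q = map_prod \<pi> \<tau> p" by (rule imageE)
    from sub(2) p(1) have "p \<in> ?I" by (rule subsetD)
    with p iff[of p] show "q \<in> matches \<epsilon> T X Y" by simp
  next
    fix q assume q: "q \<in> matches \<epsilon> T X Y"
    with sub(1) have "q \<in> map_prod \<pi> \<tau> ` ?I"
      unfolding bij_betw_imp_surj_on[OF bij] by (rule subsetD)
    then obtain p where p: "p \<in> ?I" "q = map_prod \<pi> \<tau> p" by (rule imageE)
    from q iff[OF p(1)] have "p \<in> ?M" by (simp only: p(2))
    then show "q \<in> map_prod \<pi> \<tau> ` ?M" unfolding p(2) by (rule imageI)
  qed
  with bij sub(2) show ?thesis by (rule bij_betw_subset)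
qed

text \<open>Reindexing the sum along the bijection of matches. The equality is between functions of
  the competitor \<open>S\<close>, with \<open>T\<close> fixing the matches, so that minimizers can
  be compared.\<close>

lemma procrustes_permute_list:
  assumes \<pi>: "\<pi> permutes {..<length X}" and \<tau>: "\<tau> permutes {..<length Y}"
  shows "procrustes (matches \<epsilon> T (permute_list \<pi> X) (permute_list \<tau> Y))
    (permute_list \<pi> X) (permute_list \<tau> Y) = procrustes (matches \<epsilon> T X Y) X Y"
proof
  fix S
  let ?f = "\<lambda>(i, j). (norm (act S (Y ! j) - X ! i))\<^sup>2"
  \<comment> \<open>The summand is put in the form \<open>?f\<close> after
    \<open>map_prod \<pi> \<tau>\<close>, ready for reindexing; matches have indices in range, so
    \<open>permute_list_nth\<close> applies.\<close>
  have "procrustes (matches \<epsilon> T (permute_list \<pi> X) (permute_list \<tau> Y))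
      (permute_list \<pi> X) (permute_list \<tau> Y) S =
    (\<Sum>p\<in>matches \<epsilon> T (permute_list \<pi> X) (permute_list \<tau> Y). ?f (map_prod \<pi> \<tau> p))"
    unfolding procrustes_def
    by (rule sum.cong)
      (auto simp: matches_def permute_list_nth[OF \<pi>] permute_list_nth[OF \<tau>])
  also have "\<dots> = procrustes (matches \<epsilon> T X Y) X Y S"
    unfolding procrustes_def
    by (rule sum.reindex_bij_betw[OF bij_betw_matches_permute_list[OF \<pi> \<tau>]])
  finally show "procrustes (matches \<epsilon> T (permute_list \<pi> X) (permute_list \<tau> Y))
      (permute_list \<pi> X) (permute_list \<tau> Y) S = procrustes (matches \<epsilon> T X Y) X Y S" .
qed

lemma is_registration_permute_list:
  assumes "\<pi> permutes {..<length X}" and "\<tau> permutes {..<length Y}"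
  shows "is_registration \<epsilon> (permute_list \<pi> X) (permute_list \<tau> Y) T \<longleftrightarrow>
    is_registration \<epsilon> X Y T"
  unfolding is_registration_def procrustes_permute_list[OF assms] ..

theorem proposition3p3:
  fixes \<epsilon> :: real and X Y :: cloud and \<pi> \<tau> :: "nat \<Rightarrow> nat"
  assumes "\<epsilon> > 0"
    and "(X, Y) \<in> PCR_domain \<epsilon>"
    and "\<pi> permutes {..<length X}"
    and "\<tau> permutes {..<length Y}"
  shows "(permute_list \<pi> X, permute_list \<tau> Y) \<in> PCR_domain \<epsilon> \<and>
    PCR \<epsilon> (permute_list \<pi> X) (permute_list \<tau> Y) = PCR \<epsilon> X Y"
proof -
  have "permute_list \<pi> X \<noteq> [] \<longleftrightarrow> X \<noteq> []" "permute_list \<tau> Y \<noteq> [] \<longleftrightarrow> Y \<noteq> []"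
    by (metis length_0_conv length_permute_list)+
  \<comment> \<open>After rewriting, the \<exists>! in the domain and the \<open>THE\<close> in
    \<open>PCR\<close> refer to the same predicate for both pairs.\<close>
  then show ?thesis
    using assms(2)
    unfolding PCR_domain_def PCR_def mem_Collect_eq prod.case
      is_registration_permute_list[OF assms(3,4)]
    by simp
qed

end
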